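(* Let $K\ge 2$ and let $\bm p$ be a strictly positive probability distribution on triples $(a,x,y)\in\{1,\dots,K\}^3$. Let $\bm p^*$ be obtained from $\bm p$ by an intervention on the effect $Y$, i.e. for some strictly positive distribution $\bm p^*(y)$ on $\{1,\dots,K\}$ with score vector $\mathbf s^*_Y=(s^*_y)_y$, $$\bm p^*(a,x,y)=\bm p(a)\,\bm p(x\mid a)\,\bm p^*(y)\qquad\text{for all }a,x,y$$ (equivalently, the causal scores $\mathbf s_{Y|a,x}$ are replaced, for all $a,x$, by the common vector $\mathbf s^*_Y$, while $\mathbf s_A$ and $\mathbf s_{X|A}$ are unchanged). Define $$\theta_1(a,y)=\frac1K\sum_x s_{y|a,x},\qquad \theta_2(a,x)=\frac1K\sum_y s_{x|a,y},\qquad c(a,y)=\frac{\big(\sum_x s_{y|a,x}\big)-s_{y|a}}{K-1},$$ $$R^2=\frac{(K-1)\sum_{a,y}c(a,y)^2-K\sum_{a,y}\theta_1(a,y)^2+\sum_{a,y}s_{y|a}^2+K\sum_{a,x}\big(\theta_2(a,x)-s_{x|a}\big)^2}{K-1}.$$ Let $\delta_{\text{causal}}=\|\theta_\rightarrow^{(0)}-\theta_\rightarrow^*\|^2$ and $\delta_{\text{anticausal}}=\|\theta_\leftarrow^{(0)}-\theta_\leftarrow^*\|^2$ be the squared distances between the parameters of $\bm p$ and of $\bm p^*$ in the causal and anti-causal parametrizations. If $$\sum_{a,y}\big(s^*_y-c(a,y)\big)^2<R^2,$$ then $\delta_{\text{anticausal}}\ge\delta_{\text{causal}}$.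
   Context: $A$ (bias / sensitive variable), $X$ (cause), $Y$ (effect) are categorical variables with values in $\{1,\dots,K\}$. Scores: a strictly positive distribution $(p_z)_{z=1}^K$ is represented by its score vector $\mathbf s=(s_z)_{z=1}^K\in\mathbb R^K$ with $p_z=e^{s_z}/\sum_{z'}e^{s_{z'}}$, normalized by $\sum_z s_z=0$ (so the score vector is uniquely determined by the distribution). For a joint distribution $\bm p(a,x,y)$ write $\mathbf s_A=(s_a)_a$ for the score of the marginal $\bm p(a)$; $\mathbf s_{X|a}=(s_{x|a})_x$ for the score of $\bm p(x\mid a)$; $\mathbf s_{Y|a}=(s_{y|a})_y$ for the score of $\bm p(y\mid a)$; $\mathbf s_{Y|a,x}=(s_{y|a,x})_y$ for the score of $\bm p(y\mid a,x)$; $\mathbf s_{X|a,y}=(s_{x|a,y})_x$ for the score of $\bm p(x\mid a,y)$. Each of these vectors sums to zero. Unstarred quantities are scores of $\bm p$; starred quantities are the corresponding scores of $\bm p^*$. Causal parametrization (factorization $\bm p(a)\bm p(x|a)\bm p(y|a,x)$): $\theta_\rightarrow=(\mathbf s_A,(\mathbf s_{X|a})_a,(\mathbf s_{Y|a,x})_{a,x})$. Anti-causal parametrization (factorization $\bm p(a)\bm p(y|a)\bm p(x|a,y)$): $\theta_\leftarrow=(\mathbf s_A,(\mathbf s_{Y|a})_a,(\mathbf s_{X|a,y})_{a,y})$. The superscript $(0)$ denotes the parameters of $\bm p$ and the superscript $*$ those of $\bm p^*$. Norms are Euclidean norms over all coordinates, so that $$\delta_{\text{causal}}=\|\mathbf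 s_A-\mathbf s_A^*\|^2+\sum_a\|\mathbf s_{X|a}-\mathbf s^*_{X|a}\|^2+\sum_{a,x}\|\mathbf s_{Y|a,x}-\mathbf s^*_{Y|a,x}\|^2,$$ $$\delta_{\text{anticausal}}=\|\mathbf s_A-\mathbf s_A^*\|^2+\sum_a\|\mathbf s_{Y|a}-\mathbf s^*_{Y|a}\|^2+\sum_{a,y}\|\mathbf s_{X|a,y}-\mathbf s^*_{X|a,y}\|^2.$$ *)

theory Defs
  imports "HOL-Probability.Probability"
begin

text \<open>
  The \<open>K\<close> categories are the elements of a finite type \<open>'k\<close> with \<open>K = CARD('k)\<close>; a joint
  distribution of \<open>(A, X, Y)\<close> is a pmf on triples \<open>(a, x, y)\<close>.
\<close>

definition is_score :: "'k::finite pmf \<Rightarrow> real ^ 'k \<Rightarrow> bool" where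
  "is_score q s \<longleftrightarrow>
     (\<forall>z. pmf q z = exp (s $ z) / (\<Sum>w\<in>UNIV. exp (s $ w))) \<and> (\<Sum>z\<in>UNIV. s $ z) = 0"

text \<open>Well defined only for strictly positive \<open>q\<close>, by \<open>ex1_is_score\<close> below.\<close>

definition score :: "'k::finite pmf \<Rightarrow> real ^ 'k" where
  "score q = (THE s. is_score q s)"

lemma is_score_log:
  fixes s :: "real ^ 'k::finite"
  assumes "is_score q s"
  shows "s $ z = ln (pmf q z) - (\<Sum>w\<in>UNIV. ln (pmf q w)) / real CARD('k)"
proof -
  define Z where "Z = (\<Sum>w\<in>UNIV. exp (s $ w))"
  have "Z > 0" unfolding Z_def by (rule sum_pos) auto
  have ln_q: "ln (pmf q w) = s $ w - ln Z" for w
    using assms \<open>Z > 0\<close> unfolding is_score_def Z_def[symmetric] by (simp add: ln_div)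
  have "(\<Sum>w\<in>UNIV. ln (pmf q w)) = (\<Sum>w\<in>UNIV. s $ w) - real CARD('k) * ln Z"
    unfolding ln_q by (simp add: sum_subtractf)
  then have "(\<Sum>w\<in>UNIV. ln (pmf q w)) = - real CARD('k) * ln Z"
    using assms by (simp add: is_score_def)
  then show ?thesis by (simp add: ln_q)
qed

lemma ex1_is_score:
  assumes "set_pmf (q :: 'k::finite pmf) = UNIV"
  shows "\<exists>!s. is_score q s"
proof (rule ex_ex1I)
  define m where "m = (\<Sum>w\<in>UNIV. ln (pmf q w)) / real CARD('k)"
  have pos: "pmf q z > 0" for z
    using assms by (simp add: pmf_positive)
  have e: "exp (ln (pmf q z) - m) = pmf q z / exp m" for z
    using pos by (simp add: exp_diff)
  have "(\<Sum>z\<in>UNIV. pmf q z) = 1"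
    by (rule sum_pmf_eq_1) auto
  then have "(\<Sum>z\<in>UNIV. exp (ln (pmf q z) - m)) = 1 / exp m"
    unfolding e by (simp flip: sum_divide_distrib)
  then have "pmf q z = exp (ln (pmf q z) - m) / (\<Sum>w\<in>UNIV. exp (ln (pmf q w) - m))" for z
    by (simp add: e)
  moreover have "(\<Sum>z\<in>UNIV. ln (pmf q z) - m) = 0"
    by (simp add: sum_subtractf m_def)
  ultimately have "is_score q (\<chi> z. ln (pmf q z) - m)"
    unfolding is_score_def vec_lambda_beta by blast
  then show "\<exists>s. is_score q s" ..
next
  fix s t assume "is_score q s" "is_score q t"
  then show "s = t" by (simp add: vec_eq_iff is_score_log)
qed

lemma is_score_score: "set_pmf q = UNIV \<Longrightarrow> is_score q (score q)"
  unfolding score_def by (rule theI') (rule ex1_is_score)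

definition dist_A :: "('k \<times> 'k \<times> 'k) pmf \<Rightarrow> 'k pmf" where
  "dist_A p = map_pmf (\<lambda>(a, _, _). a) p"

definition dist_X_A :: "('k \<times> 'k \<times> 'k) pmf \<Rightarrow> 'k \<Rightarrow> 'k pmf" where
  "dist_X_A p a = map_pmf (\<lambda>(_, x, _). x) (cond_pmf p {(a', _, _). a' = a})"

definition dist_Y_A :: "('k \<times> 'k \<times> 'k) pmf \<Rightarrow> 'k \<Rightarrow> 'k pmf" where
  "dist_Y_A p a = map_pmf (\<lambda>(_, _, y). y) (cond_pmf p {(a', _, _). a' = a})"

definition dist_Y_AX :: "('k \<times> 'k \<times> 'k) pmf \<Rightarrow> 'k \<Rightarrow> 'k \<Rightarrow> 'k pmf" where
  "dist_Y_AX p a x =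
     map_pmf (\<lambda>(_, _, y). y) (cond_pmf p {(a', x', _). a' = a \<and> x' = x})"

definition dist_X_AY :: "('k \<times> 'k \<times> 'k) pmf \<Rightarrow> 'k \<Rightarrow> 'k \<Rightarrow> 'k pmf" where
  "dist_X_AY p a y =
     map_pmf (\<lambda>(_, x, _). x) (cond_pmf p {(a', _, y'). a' = a \<and> y' = y})"

text \<open>
  The norms on products and on \<open>real ^ 'k\<close> are both Euclidean, so the norm of a parameter tuple
  is the Euclidean norm over all its coordinates.
\<close>

type_synonym 'k params = "(real ^ 'k) \<times> (real ^ 'k ^ 'k) \<times> (real ^ 'k ^ 'k ^ 'k)"

definition causal_params :: "('k::finite \<times> 'k \<times> 'k) pmf \<Rightarrow> 'k params" where
  "causal_params p =
     (score (dist_A p), \<chi> a. score (dist_X_A p a), \<chi> a x. score (dist_Y_AX p a x))"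

definition anticausal_params :: "('k::finite \<times> 'k \<times> 'k) pmf \<Rightarrow> 'k params" where
  "anticausal_params p =
     (score (dist_A p), \<chi> a. score (dist_Y_A p a), \<chi> a y. score (dist_X_AY p a y))"

definition delta_causal ::
    "('k::finite \<times> 'k \<times> 'k) pmf \<Rightarrow> ('k \<times> 'k \<times> 'k) pmf \<Rightarrow> real" where
  "delta_causal p p' = (norm (causal_params p - causal_params p'))\<^sup>2"

definition delta_anticausal ::
    "('k::finite \<times> 'k \<times> 'k) pmf \<Rightarrow> ('k \<times> 'k \<times> 'k) pmf \<Rightarrow> real" where
  "delta_anticausal p p' = (norm (anticausal_params p - anticausal_params p'))\<^sup>2"

lemma norm_vec_sq: "(norm v)\<^sup>2 = (\<Sum>i\<in>UNIV. (norm (v $ i))\<^sup>2)"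
  by (simp add: norm_vec_def L2_set_def sum_nonneg)

lemma delta_causal_eq:
  "delta_causal p p' =
     (norm (score (dist_A p) - score (dist_A p')))\<^sup>2
     + (\<Sum>a\<in>UNIV. (norm (score (dist_X_A p a) - score (dist_X_A p' a)))\<^sup>2)
     + (\<Sum>a\<in>UNIV. \<Sum>x\<in>UNIV. (norm (score (dist_Y_AX p a x) - score (dist_Y_AX p' a x)))\<^sup>2)"
  by (simp add: delta_causal_def causal_params_def norm_Pair sum_nonneg
      norm_vec_sq[of "_ :: _ ^ _ ^ _"])

lemma delta_anticausal_eq:
  "delta_anticausal p p' =
     (norm (score (dist_A p) - score (dist_A p')))\<^sup>2
     + (\<Sum>a\<in>UNIV. (norm (score (dist_Y_A p a) - score (dist_Y_A p' a)))\<^sup>2)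
     + (\<Sum>a\<in>UNIV. \<Sum>y\<in>UNIV. (norm (score (dist_X_AY p a y) - score (dist_X_AY p' a y)))\<^sup>2)"
  by (simp add: delta_anticausal_def anticausal_params_def norm_Pair sum_nonneg
      norm_vec_sq[of "_ :: _ ^ _ ^ _"])

definition theta1 :: "('k::finite \<times> 'k \<times> 'k) pmf \<Rightarrow> 'k \<Rightarrow> 'k \<Rightarrow> real" where
  "theta1 p a y = (1 / real CARD('k)) * (\<Sum>x\<in>UNIV. score (dist_Y_AX p a x) $ y)"

definition theta2 :: "('k::finite \<times> 'k \<times> 'k) pmf \<Rightarrow> 'k \<Rightarrow> 'k \<Rightarrow> real" where
  "theta2 p a x = (1 / real CARD('k)) * (\<Sum>y\<in>UNIV. score (dist_X_AY p a y) $ x)"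

definition center :: "('k::finite \<times> 'k \<times> 'k) pmf \<Rightarrow> 'k \<Rightarrow> 'k \<Rightarrow> real" where
  "center p a y =
     ((\<Sum>x\<in>UNIV. score (dist_Y_AX p a x) $ y) - score (dist_Y_A p a) $ y)
       / (real CARD('k) - 1)"

text \<open>This is the quantity written \<open>R\<close> squared; it is not claimed to be nonnegative.\<close>

definition radius_sq :: "('k::finite \<times> 'k \<times> 'k) pmf \<Rightarrow> real" where
  "radius_sq p =
     ((real CARD('k) - 1) * (\<Sum>a\<in>UNIV. \<Sum>y\<in>UNIV. (center p a y)\<^sup>2)
      - real CARD('k) * (\<Sum>a\<in>UNIV. \<Sum>y\<in>UNIV. (theta1 p a y)\<^sup>2)
      + (\<Sum>a\<in>UNIV. \<Sum>y\<in>UNIV. (score (dist_Y_A p a) $ y)\<^sup>2)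
      + real CARD('k) * (\<Sum>a\<in>UNIV. \<Sum>x\<in>UNIV. (theta2 p a x - score (dist_X_A p a) $ x)\<^sup>2))
     / (real CARD('k) - 1)"

end

theory Submission
  imports Defs
begin

text \<open>
  For fixed \<open>a\<close>, the scores of \<open>p(y | a, x)\<close> centred over \<open>x\<close> and the scores of \<open>p(x | a, y)\<close>
  centred over \<open>y\<close> both equal the doubly centred matrix \<open>ln p(a, x, y)\<close>. Splitting each squared
  distance into variance and squared bias, this common interaction term cancels, and completing the
  square leaves
  \<open>\<delta>_anticausal - \<delta>_causal = (K - 1) (R^2 - \<Sum>a,y. (s*_y - c(a, y))^2)\<close>.
\<close>

text \<open>The normalizer \<open>c\<close> shifts every logarithm by the same amount, and centring
  removes the shift. Scores of conditionals can thus be read off from unnormalized joint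
  weights.\<close>

lemma score_eq_ln:
  fixes q :: "'k::finite pmf"
  assumes "\<And>z. pmf q z = f z / c" "\<And>z. f z > 0" "c > 0"
  shows "score q $ z = ln (f z) - (\<Sum>w\<in>UNIV. ln (f w)) / real CARD('k)"
proof -
  have "pmf q w \<noteq> 0" for w
    using assms(2)[of w] assms(3) by (simp add: assms(1))
  then have "set_pmf q = UNIV"
    by (auto simp: set_pmf_iff)
  moreover have "ln (pmf q w) = ln (f w) - ln c" for w
    unfolding assms(1) by (rule ln_divide_pos[OF assms(2,3)])
  ultimately show ?thesis
    by (simp add: is_score_log[OF is_score_score] sum_subtractf diff_divide_distrib)
qed

text \<open>The hypothesis says that \<open>S\<close> has positive mass, so that
  \<open>cond_pmf p S\<close> is the genuine conditional law and its masses are ratios of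
  probabilities.\<close>

lemma pmf_map_cond_pmf:
  assumes "set_pmf p \<inter> S \<noteq> {}"
  shows "pmf (map_pmf f (cond_pmf p S)) z = measure_pmf.prob p {w \<in> S. f w = z} / measure_pmf.prob p S"
proof -
  have "S \<inter> f -` {z} = {w \<in> S. f w = z}"
    by auto
  then show ?thesis
    using assms by (simp add: pmf_map cond_pmf.rep_eq emeasure_measure_pmf_not_zero)
qed

lemma prob_eq_sum:
  fixes p :: "('k::finite \<times> 'k \<times> 'k) pmf"
  shows "measure_pmf.prob p S =
    (\<Sum>a\<in>UNIV. \<Sum>x\<in>UNIV. \<Sum>y\<in>UNIV. if (a, x, y) \<in> S then pmf p (a, x, y) else 0)"
proof -
  have "measure_pmf.prob p S = (\<Sum>z\<in>UNIV. if z \<in> S then pmf p z else 0)"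
    by (simp add: measure_measure_pmf_finite sum.If_cases)
  also have "\<dots> = (\<Sum>a\<in>UNIV. \<Sum>x\<in>UNIV. \<Sum>y\<in>UNIV. if (a, x, y) \<in> S then pmf p (a, x, y) else 0)"
    by (simp add: sum.cartesian_product split_def cong: if_cong)
  finally show ?thesis .
qed

text \<open>With \<open>if_conj\<close>, this moves each constraint out of the sums over the other
  coordinates, so that the triple sum in \<open>prob_eq_sum\<close> collapses to the free
  coordinates.\<close>

lemma sum_if_const:
  "(\<Sum>z\<in>A. if b then f z else 0) = (if b then \<Sum>z\<in>A. f z else (0 :: real))"
  by simp

lemma if_conj: "(if b \<and> c then u else (0 :: real)) = (if b then if c then u else 0 else 0)"
  by simp

lemma pmf_dist_A:
  fixes p :: "('k::finite \<times> 'k \<times> 'k) pmf"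
  shows "pmf (dist_A p) a = (\<Sum>x\<in>UNIV. \<Sum>y\<in>UNIV. pmf p (a, x, y))"
  by (simp add: dist_A_def pmf_map vimage_def split_def prob_eq_sum sum_if_const)

lemma pmf_dist_X_A:
  fixes p :: "('k::finite \<times> 'k \<times> 'k) pmf"
  assumes "set_pmf p = UNIV"
  shows "pmf (dist_X_A p a) x = (\<Sum>y\<in>UNIV. pmf p (a, x, y)) / pmf (dist_A p) a"
  using assms unfolding dist_X_A_def pmf_dist_A
  by (subst pmf_map_cond_pmf) (auto simp: split_def prob_eq_sum if_conj sum_if_const)

lemma pmf_dist_Y_A:
  fixes p :: "('k::finite \<times> 'k \<times> 'k) pmf"
  assumes "set_pmf p = UNIV"
  shows "pmf (dist_Y_A p a) y = (\<Sum>x\<in>UNIV. pmf p (a, x, y)) / pmf (dist_A p) a"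
  using assms unfolding dist_Y_A_def pmf_dist_A
  by (subst pmf_map_cond_pmf) (auto simp: split_def prob_eq_sum if_conj sum_if_const)

lemma pmf_dist_Y_AX:
  fixes p :: "('k::finite \<times> 'k \<times> 'k) pmf"
  assumes "set_pmf p = UNIV"
  shows "pmf (dist_Y_AX p a x) y = pmf p (a, x, y) / (\<Sum>y\<in>UNIV. pmf p (a, x, y))"
  using assms unfolding dist_Y_AX_def
  by (subst pmf_map_cond_pmf) (auto simp: split_def prob_eq_sum if_conj sum_if_const)

lemma pmf_dist_X_AY:
  fixes p :: "('k::finite \<times> 'k \<times> 'k) pmf"
  assumes "set_pmf p = UNIV"
  shows "pmf (dist_X_AY p a y) x = pmf p (a, x, y) / (\<Sum>x\<in>UNIV. pmf p (a, x, y))"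
  using assms unfolding dist_X_AY_def
  by (subst pmf_map_cond_pmf) (auto simp: split_def prob_eq_sum if_conj sum_if_const)

lemma sum_pmf_UNIV: "(\<Sum>z\<in>UNIV. pmf (q :: 'k::finite pmf) z) = 1"
  by (rule sum_pmf_eq_1) auto

context
  fixes p p_star :: "('k::finite \<times> 'k \<times> 'k) pmf" and q :: "'k pmf"
  assumes p: "set_pmf p = UNIV" and q: "set_pmf q = UNIV"
    and p_star: "\<And>a x y. pmf p_star (a, x, y) = pmf (dist_A p) a * pmf (dist_X_A p a) x * pmf q y"
begin

lemma pmf_p_pos: "pmf p z > 0"
  using p by (simp add: pmf_positive)

lemma pmf_dist_A_pos: "pmf (dist_A p) a > 0"
  unfolding pmf_dist_A by (intro sum_pos pmf_p_pos) auto

lemma pmf_dist_X_A_pos: "pmf (dist_X_A p a) x > 0"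
  unfolding pmf_dist_X_A[OF p] by (intro divide_pos_pos sum_pos pmf_p_pos pmf_dist_A_pos) auto

lemma pmf_q_pos: "pmf q y > 0"
  using q by (simp add: pmf_positive)

lemma set_p_star: "set_pmf p_star = UNIV"
proof -
  have "pmf p_star z > 0" for z
    by (cases z) (simp add: p_star pmf_dist_A_pos pmf_dist_X_A_pos pmf_q_pos)
  then show ?thesis
    by (auto simp: set_pmf_iff less_le)
qed

lemma dist_A_p_star: "dist_A p_star = dist_A p"
  by (rule pmf_eqI)
    (simp add: pmf_dist_A[of p_star] p_star sum_pmf_UNIV flip: sum_distrib_left)

lemma dist_X_A_p_star: "dist_X_A p_star a = dist_X_A p a"
  using pmf_dist_A_pos[of a]
  by (intro pmf_eqI)
    (simp add: pmf_dist_X_A[OF set_p_star] dist_A_p_star p_star sum_pmf_UNIV flip: sum_distrib_left)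

text \<open>Under \<open>p_star\<close>, Y is independent of (A, X), hence conditioning on A leaves
  the law \<open>q\<close>.\<close>

lemma dist_Y_A_p_star: "dist_Y_A p_star a = q"
  using pmf_dist_A_pos[of a]
  by (intro pmf_eqI)
    (simp add: pmf_dist_Y_A[OF set_p_star] dist_A_p_star p_star sum_pmf_UNIV
      flip: sum_distrib_left sum_distrib_right)

lemma dist_Y_AX_p_star: "dist_Y_AX p_star a x = q"
  using pmf_dist_A_pos[of a] pmf_dist_X_A_pos[of a x]
  by (intro pmf_eqI)
    (simp add: pmf_dist_Y_AX[OF set_p_star] p_star sum_pmf_UNIV flip: sum_distrib_left)

text \<open>X and Y are independent given A under \<open>p_star\<close>, so the value of Y carries
  no information about X once A is known.\<close>

lemma dist_X_AY_p_star: "dist_X_AY p_star a y = dist_X_A p a"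
  using pmf_dist_A_pos[of a] pmf_q_pos[of y]
  by (intro pmf_eqI)
    (simp add: pmf_dist_X_AY[OF set_p_star] p_star sum_pmf_UNIV
      flip: sum_distrib_left sum_distrib_right)

end

text \<open>Taking a score in one variable centres the log-weights over it, and subtracting
  \<open>theta1\<close> or \<open>theta2\<close> centres over the other. The two centrings
  commute.\<close>

lemma centred_scores_eq:
  fixes p :: "('k::finite \<times> 'k \<times> 'k) pmf"
  assumes p: "set_pmf p = UNIV"
  shows "score (dist_Y_AX p a x) $ y - theta1 p a y = score (dist_X_AY p a y) $ x - theta2 p a x"
proof -
  define L where "L x y = ln (pmf p (a, x, y))" for x y
  define K where "K = real CARD('k)"
  have pos: "pmf p z > 0" for z
    using p by (simp add: pmf_positive)
  have Y: "score (dist_Y_AX p a x) $ y = L x y - (\<Sum>y\<in>UNIV. L x y) / K" for x y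
    unfolding L_def K_def by (rule score_eq_ln[OF pmf_dist_Y_AX[OF p]]) (auto intro!: sum_pos pos)
  have X: "score (dist_X_AY p a y) $ x = L x y - (\<Sum>x\<in>UNIV. L x y) / K" for x y
    unfolding L_def K_def by (rule score_eq_ln[OF pmf_dist_X_AY[OF p]]) (auto intro!: sum_pos pos)
  have "theta1 p a y = ((\<Sum>x\<in>UNIV. L x y) - (\<Sum>x\<in>UNIV. \<Sum>y\<in>UNIV. L x y) / K) / K"
    unfolding theta1_def Y by (simp add: sum_subtractf sum_divide_distrib K_def)
  moreover have "theta2 p a x = ((\<Sum>y\<in>UNIV. L x y) - (\<Sum>x\<in>UNIV. \<Sum>y\<in>UNIV. L x y) / K) / K"
    unfolding theta2_def X
    by (subst sum.swap) (simp add: sum_subtractf sum_divide_distrib K_def)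
  ultimately show ?thesis
    by (simp add: X Y diff_divide_distrib)
qed

text \<open>Variance plus squared bias: the cross term vanishes because deviations from the mean sum
  to zero. The mean is written in the same form as in \<open>theta1\<close> and
  \<open>theta2\<close>.\<close>

lemma sum_power2_diff_mean:
  fixes f :: "'k::finite \<Rightarrow> real"
  defines "m \<equiv> (1 / real CARD('k)) * (\<Sum>z\<in>UNIV. f z)"
  shows "(\<Sum>z\<in>UNIV. (f z - t)\<^sup>2) = (\<Sum>z\<in>UNIV. (f z - m)\<^sup>2) + real CARD('k) * (m - t)\<^sup>2"
proof -
  \<comment> \<open>Expand the square of (f z - m) + (m - t), keeping the cross term linear in
    \<open>f z\<close> so that it can be summed separately.\<close>
  have "(\<Sum>z\<in>UNIV. (f z - t)\<^sup>2) =
      (\<Sum>z\<in>UNIV. (f z - m)\<^sup>2 + (2 * (m - t) * f z - 2 * (m - t) * m + (m - t)\<^sup>2))"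
    by (intro sum.cong) (auto simp: power2_eq_square algebra_simps)
  also have "\<dots> = (\<Sum>z\<in>UNIV. (f z - m)\<^sup>2)
      + (2 * (m - t) * (\<Sum>z\<in>UNIV. f z) - real CARD('k) * (2 * (m - t) * m) + real CARD('k) * (m - t)\<^sup>2)"
    by (simp add: sum.distrib sum_subtractf flip: sum_distrib_left)
  also have "(\<Sum>z\<in>UNIV. f z) = real CARD('k) * m"
    by (simp add: m_def)
  finally show ?thesis
    by (simp add: algebra_simps)
qed

theorem proposition2:
  fixes p p_star :: "('k::finite \<times> 'k \<times> 'k) pmf"
    and q :: "'k pmf"
  assumes "CARD('k) \<ge> 2"
    and "set_pmf p = UNIV"
    and "set_pmf q = UNIV"
    and "\<And>a x y. pmf p_star (a, x, y) = pmf (dist_A p) a * pmf (dist_X_A p a) x * pmf q y"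
    and "(\<Sum>a\<in>(UNIV :: 'k set). \<Sum>y\<in>UNIV. (score q $ y - center p a y)\<^sup>2) < radius_sq p"
  shows "delta_anticausal p p_star \<ge> delta_causal p p_star"
proof -
  define K where "K = real CARD('k)"
  define s where "s y = score q $ y" for y
  \<comment> \<open>\<open>I\<close> is the interaction term; its total square \<open>J\<close> is
    the variance part common to both distances.\<close>
  define I where "I a x y = score (dist_Y_AX p a x) $ y - theta1 p a y" for a x y
  define B where "B = (\<Sum>a\<in>UNIV. \<Sum>x\<in>UNIV. (theta2 p a x - score (dist_X_A p a) $ x)\<^sup>2)"
  define J where "J = (\<Sum>a\<in>UNIV. \<Sum>x\<in>UNIV. \<Sum>y\<in>UNIV. (I a x y)\<^sup>2)"
  have K: "K > 1"
    using assms(1) by (simp add: K_def)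
  note star = dist_A_p_star[OF assms(2-4)] dist_X_A_p_star[OF assms(2-4)]
    dist_Y_A_p_star[OF assms(2-4)] dist_Y_AX_p_star[OF assms(2-4)] dist_X_AY_p_star[OF assms(2-4)]
  note norm_sq = norm_vec_sq[of "_ :: real ^ 'k"]

  have "(\<Sum>x\<in>UNIV. (score (dist_Y_AX p a x) $ y - s y)\<^sup>2) =
      (\<Sum>x\<in>UNIV. (I a x y)\<^sup>2) + K * (theta1 p a y - s y)\<^sup>2" for a y
    unfolding I_def theta1_def K_def by (rule sum_power2_diff_mean)
  then have "(\<Sum>x\<in>UNIV. \<Sum>y\<in>UNIV. (score (dist_Y_AX p a x) $ y - s y)\<^sup>2) =
      (\<Sum>x\<in>UNIV. \<Sum>y\<in>UNIV. (I a x y)\<^sup>2) + K * (\<Sum>y\<in>UNIV. (theta1 p a y - s y)\<^sup>2)" for a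
    by (subst (1 2) sum.swap) (simp add: sum.distrib sum_distrib_left)
  \<comment> \<open>The intervention fixes the laws of A and of X given A, so only the Y scores
    contribute.\<close>
  then have causal: "delta_causal p p_star =
      J + K * (\<Sum>a\<in>UNIV. \<Sum>y\<in>UNIV. (theta1 p a y - s y)\<^sup>2)"
    by (simp add: delta_causal_eq star norm_sq J_def s_def sum.distrib sum_distrib_left)

  \<comment> \<open>The same \<open>I\<close> appears because \<open>centred_scores_eq\<close>
    rewrites it as the score of X given (a, y) minus its mean over y.\<close>
  have "(\<Sum>y\<in>UNIV. (score (dist_X_AY p a y) $ x - score (dist_X_A p a) $ x)\<^sup>2) =
      (\<Sum>y\<in>UNIV. (I a x y)\<^sup>2) + K * (theta2 p a x - score (dist_X_A p a) $ x)\<^sup>2" for a x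
    unfolding I_def centred_scores_eq[OF assms(2)] theta2_def K_def by (rule sum_power2_diff_mean)
  then have "(\<Sum>y\<in>UNIV. \<Sum>x\<in>UNIV. (score (dist_X_AY p a y) $ x - score (dist_X_A p a) $ x)\<^sup>2) =
      (\<Sum>x\<in>UNIV. \<Sum>y\<in>UNIV. (I a x y)\<^sup>2)
      + K * (\<Sum>x\<in>UNIV. (theta2 p a x - score (dist_X_A p a) $ x)\<^sup>2)" for a
    by (subst sum.swap) (simp add: sum.distrib sum_distrib_left)
  then have anticausal: "delta_anticausal p p_star =
      (\<Sum>a\<in>UNIV. \<Sum>y\<in>UNIV. (score (dist_Y_A p a) $ y - s y)\<^sup>2) + (J + K * B)"
    by (simp add: delta_anticausal_eq star norm_sq J_def B_def s_def sum.distrib sum_distrib_left)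

  \<comment> \<open>The left side is a quadratic in \<open>s y\<close> with leading coefficient -(K
    - 1); its vertex is \<open>center p a y\<close>.\<close>
  have square: "(score (dist_Y_A p a) $ y - s y)\<^sup>2 - K * (theta1 p a y - s y)\<^sup>2 =
      (K - 1) * (center p a y)\<^sup>2 - K * (theta1 p a y)\<^sup>2 + (score (dist_Y_A p a) $ y)\<^sup>2
      - (K - 1) * (s y - center p a y)\<^sup>2" for a y
  proof -
    have "K * theta1 p a y = (\<Sum>x\<in>UNIV. score (dist_Y_AX p a x) $ y)"
      by (simp add: theta1_def K_def)
    then have "(K - 1) * center p a y = K * theta1 p a y - score (dist_Y_A p a) $ y"
      using K by (simp add: center_def K_def)
    then show ?thesis
      by algebra
  qed
  have "delta_anticausal p p_star - delta_causal p p_star =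
      (\<Sum>a\<in>UNIV. \<Sum>y\<in>UNIV. (score (dist_Y_A p a) $ y - s y)\<^sup>2 - K * (theta1 p a y - s y)\<^sup>2) + K * B"
    by (simp add: causal anticausal sum_subtractf sum_distrib_left)
  \<comment> \<open>The factor K - 1 clears the denominator of \<open>radius_sq\<close>; being
    positive, it leaves the sign to the ball condition.\<close>
  also have "\<dots> = (K - 1) * (radius_sq p - (\<Sum>a\<in>UNIV. \<Sum>y\<in>UNIV. (s y - center p a y)\<^sup>2))"
    using K unfolding square radius_sq_def K_def[symmetric] B_def[symmetric]
    by (simp add: sum_subtractf sum.distrib right_diff_distrib flip: sum_distrib_left)
  also have "\<dots> > 0"
    using K assms(5) by (simp add: s_def)
  finally show ?thesis
    by simp
qed

end
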